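(* Let $n\geq 2k+1$ and $i\geq k+1$. Suppose that $\mathcal{L}$ is a Cameron-Liebler $k$-set in $\mathrm{AG}(n,q)$, such that there exists an $i$-space $\pi$ in $\mathrm{AG}(n,q)$, with $\mathcal{L}\cap[\pi]_k$ the set of $k$-spaces (in $\pi$) through a fixed point $p$. Then $\mathcal{L}$ is a Cameron-Liebler $k$-set of parameter $x=1$ and, hence, the set of $k$-spaces through $p$.
   Context: A Cameron-Liebler $k$-set in $\mathrm{AG}(n,q)$ is a set $\mathcal{L}$ of $k$-spaces whose characteristic vector lies in the row space of the point-($k$-space) incidence matrix of $\mathrm{AG}(n,q)$; it has parameter $x$ if $|\mathcal{L}|=x\begin{bmatrix} n \\ k\end{bmatrix}_q$, where $\begin{bmatrix} b \\ a\end{bmatrix}_q=\frac{(q^b-1)\cdots(q^{b-a+1}-1)}{(q^a-1)\cdots(q-1)}$. $[\pi]_k$ denotes the set of $k$-spaces contained in $\pi$. *)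

theory Defs
  imports "HOL-Analysis.Analysis"
begin

text \<open>
  \<open>AG(n,q)\<close> is the affine geometry of \<open>'a ^ 'n\<close>, where \<open>'a\<close> is a finite field with
  \<open>CARD('a) = q\<close> and \<open>CARD('n) = n\<close>. Its points are the vectors, and its \<open>k\<close>-spaces are the
  cosets of the \<open>k\<close>-dimensional linear subspaces.
\<close>

definition ag_spaces :: "nat \<Rightarrow> ('a::{field,finite} ^ 'n) set set" where
  "ag_spaces k = {A. \<exists>a W. vec.subspace W \<and> vec.dim W = k \<and> A = (\<lambda>w. a + w) ` W}"

definition ag_spaces_in :: "nat \<Rightarrow> ('a::{field,finite} ^ 'n) set \<Rightarrow> ('a ^ 'n) set set" where
  "ag_spaces_in k U = {K \<in> ag_spaces k. K \<subseteq> U}"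

definition incidence_matrix :: "'p \<Rightarrow> 'p set \<Rightarrow> real" where
  "incidence_matrix P K = of_bool (P \<in> K)"

definition char_vector :: "'b set \<Rightarrow> 'b \<Rightarrow> real" where
  "char_vector S b = of_bool (b \<in> S)"

text \<open>
  Row space over the reals of a matrix \<open>M\<close> with finite row index set \<open>R\<close> and column index set
  \<open>C\<close>: all real linear combinations of the rows. A vector indexed by \<open>C\<close> is a total function of
  which only the values on \<open>C\<close> matter.
\<close>

definition row_space :: "'r set \<Rightarrow> 'c set \<Rightarrow> ('r \<Rightarrow> 'c \<Rightarrow> real) \<Rightarrow> ('c \<Rightarrow> real) set" where
  "row_space R C M = {v. \<exists>c :: 'r \<Rightarrow> real. \<forall>j\<in>C. v j = (\<Sum>i\<in>R. c i * M i j)}"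

definition cameron_liebler :: "nat \<Rightarrow> ('a::{field,finite} ^ 'n) set set \<Rightarrow> bool" where
  "cameron_liebler k L \<longleftrightarrow>
     L \<subseteq> ag_spaces k \<and> char_vector L \<in> row_space UNIV (ag_spaces k) incidence_matrix"

definition gauss_binomial :: "nat \<Rightarrow> nat \<Rightarrow> nat \<Rightarrow> real" where
  "gauss_binomial q b a =
     (\<Prod>j<a. (real q ^ (b - j) - 1)) / (\<Prod>j<a. (real q ^ (a - j) - 1))"

definition has_parameter :: "nat \<Rightarrow> ('a::{field,finite} ^ 'n) set set \<Rightarrow> real \<Rightarrow> bool" where
  "has_parameter k L x \<longleftrightarrow> real (card L) = x * gauss_binomial CARD('a) CARD('n) k"

end

theory Submission imports Defs begin

text \<open>
  Write the characteristic vector of \<open>\<L>\<close> as \<open>K \<mapsto> (\<Sum>P\<in>K. c P)\<close> for point weights \<open>c\<close>. In a \<open>(k+1)\<close>-space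
  \<open>F\<close>, each point lies on the same number \<open>\<theta>\<close> of hyperplanes of \<open>F\<close> and each pair of points on the same
  number \<open>\<lambda> < \<theta>\<close>, so the hyperplane sums through \<open>P\<close> add up to \<open>(\<theta> - \<lambda>) c P + \<lambda> c(F)\<close>, where \<open>c(F)\<close> is the
  total weight of \<open>F\<close>. Taking \<open>F\<close> inside \<open>\<pi>\<close>, where \<open>\<L>\<close> is a pencil, gives \<open>c p = 1\<close>. Any other point lies
  in some \<open>F\<close> containing a \<open>k\<close>-space of \<open>\<L>\<close> through \<open>p\<close>; averaging at \<open>p\<close> there gives \<open>c(F) = 1\<close> and
  puts every hyperplane of \<open>F\<close> through \<open>p\<close>, and no other one, into \<open>\<L>\<close>. Averaging at the other point now
  shows that its weight is \<open>0\<close>, so \<open>c\<close> is the indicator of \<open>p\<close>.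
\<close>

section \<open>Subspaces of a finite vector space\<close>

text \<open>Slices the span into translates of \<open>W\<close> along \<open>e\<close>, for use in
  cardinalities, in coset sums and in counting linear forms. Slices with distinct scalars cannot
  meet: dividing by the difference of the scalars would put \<open>e\<close> into
  \<open>W\<close>.\<close>

lemma bij_betw_span_insert:
  fixes W :: "('a::field ^ 'n) set"
  assumes W: "vec.subspace W" and e: "e \<notin> W"
  shows "bij_betw (\<lambda>(t, w). t *s e + w) (UNIV \<times> W) (vec.span (insert e W))"
proof -
  have "inj_on (\<lambda>(t, w). t *s e + w) (UNIV \<times> W)"
  proof (rule inj_onI, clarify)
    fix t w t' w'
    assume w: "w \<in> W" "w' \<in> W" and eq: "t *s e + w = t' *s e + w'"
    have *: "(t - t') *s e = w' - w"
      using eq by (simp add: vec.scale_left_diff_distrib algebra_simps)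
    have "t = t'"
    proof (rule ccontr)
      assume "t \<noteq> t'"
      hence "e = inverse (t - t') *s ((t - t') *s e)"
        by (simp only: vec.scale_scale) simp
      also have "\<dots> \<in> W" unfolding * by (intro vec.subspace_scale vec.subspace_diff W w)
      finally show False using e by simp
    qed
    with eq show "t = t' \<and> w = w'" by simp
  qed
  moreover have "(\<lambda>(t, w). t *s e + w) ` (UNIV \<times> W) = vec.span (insert e W)"
  proof -
    have "x \<in> (\<lambda>(t, w). t *s e + w) ` (UNIV \<times> W) \<longleftrightarrow> x \<in> vec.span (insert e W)" for x
    proof
      assume "x \<in> (\<lambda>(t, w). t *s e + w) ` (UNIV \<times> W)"
      thus "x \<in> vec.span (insert e W)"
        by (auto intro!: vec.span_add vec.span_scale intro: vec.span_base)
    next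
      assume "x \<in> vec.span (insert e W)"
      then obtain t where "x - t *s e \<in> W"
        using W by (metis vec.span_breakdown_eq vec.span_eq_iff)
      thus "x \<in> (\<lambda>(t, w). t *s e + w) ` (UNIV \<times> W)"
        by (intro image_eqI[where x = "(t, x - t *s e)"]) auto
    qed
    thus ?thesis by blast
  qed
  ultimately show ?thesis by (simp add: bij_betw_def)
qed

lemma card_subspace:
  fixes W :: "('a::{field,finite} ^ 'n) set"
  assumes "vec.subspace W"
  shows "card W = CARD('a) ^ vec.dim W"
proof -
  have span: "card (vec.span B) = CARD('a) ^ card B" if "finite B" "vec.independent B"
    for B :: "('a ^ 'n) set"
    using that
  proof (induction B rule: finite_induct)
    case (insert e B)
    hence e: "e \<notin> vec.span B" and B: "vec.independent B"
      by (auto simp: vec.independent_insert)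
    have "card (vec.span (insert e B)) = card (vec.span (insert e (vec.span B)))"
      by (simp add: vec.span_insert vec.span_span)
    also have "\<dots> = card ((UNIV :: 'a set) \<times> vec.span B)"
      using bij_betw_same_card[OF bij_betw_span_insert[OF vec.subspace_span e]] by simp
    finally show ?case using insert B by (simp add: card_cartesian_product)
  qed simp
  obtain B where "finite B" "vec.independent B" "vec.span B = W" "card B = vec.dim W"
    by (rule vec.basis_subspace_exists[OF assms])
  with span[of B] show ?thesis by simp
qed

lemma hyperplane_span_insert:
  fixes E W :: "('a::field ^ 'n) set"
  assumes "vec.subspace E" "vec.subspace W" "W \<subseteq> E" "vec.dim E = Suc (vec.dim W)"
    and "e \<in> E" "e \<notin> W"
  shows "vec.span (insert e W) = E"
proof (rule vec.subspace_dim_equal)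
  show "vec.span (insert e W) \<subseteq> E"
    using assms by (intro vec.span_minimal) auto
  have "vec.dim (insert e W) = Suc (vec.dim W)"
    using assms by (simp add: vec.dim_insert vec.span_eq_iff[THEN iffD2])
  thus "vec.dim E \<le> vec.dim (vec.span (insert e W))"
    using assms by simp
qed (use assms in auto)

lemma subspace_of_dim_exists:
  fixes V :: "('a::field ^ 'n) set"
  assumes "vec.subspace V" "m \<le> vec.dim V"
  obtains W where "vec.subspace W" "W \<subseteq> V" "vec.dim W = m"
proof -
  obtain B where B: "finite B" "vec.independent B" "vec.span B = V" "card B = vec.dim V"
    by (rule vec.basis_subspace_exists[OF assms(1)])
  obtain C where C: "C \<subseteq> B" "card C = m"
    using B(4) assms(2) by (metis obtain_subset_with_card_n)
  show thesis
  proof (rule that[of "vec.span C"])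
    show "vec.span C \<subseteq> V" using vec.span_mono[OF C(1)] B(3) by simp
    show "vec.dim (vec.span C) = m"
      using vec.independent_mono[OF B(2) C(1)] C(2) by (simp add: vec.dim_eq_card_independent)
  qed simp
qed

section \<open>Counting subspaces\<close>

text \<open>Ordered tuples instead of sets, so that they can be built one vector at a time and their
  number is a plain product.\<close>

definition independent_lists :: "('a::field ^ 'n) set \<Rightarrow> nat \<Rightarrow> ('a ^ 'n) list set" where
  "independent_lists E m =
     {xs. length xs = m \<and> distinct xs \<and> set xs \<subseteq> E \<and> vec.independent (set xs)}"

lemma finite_independent_lists:
  "finite (independent_lists (E :: ('a::{field,finite} ^ 'n) set) m)"
  by (rule finite_subset[OF _ finite_lists_length_eq[of E m]]) (auto simp: independent_lists_def)

text \<open>A list of length \<open>j\<close> extends by exactly the vectors of \<open>E\<close>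
  outside its span, which has \<open>q ^ j\<close> elements. As \<open>m \<le> vec.dim E\<close>, no
  subtraction of naturals is truncated.\<close>

lemma card_independent_lists:
  fixes E :: "('a::{field,finite} ^ 'n) set"
  assumes E: "vec.subspace E"
  shows "m \<le> vec.dim E \<Longrightarrow>
    card (independent_lists E m) = (\<Prod>j<m. CARD('a) ^ vec.dim E - CARD('a) ^ j)"
proof (induction m)
  case 0
  have "independent_lists E 0 = {[]}"
    by (auto simp: independent_lists_def vec.independent_empty)
  thus ?case by simp
next
  case (Suc m)
  have "independent_lists E (Suc m) =
      (\<lambda>(xs, x). x # xs) ` (SIGMA xs : independent_lists E m. E - vec.span (set xs))"
  proof (intro equalityI subsetI)
    fix ys assume ys: "ys \<in> independent_lists E (Suc m)"
    then obtain x xs where "ys = x # xs"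
      by (cases ys) (auto simp: independent_lists_def)
    with ys show "ys \<in> (\<lambda>(xs, x). x # xs) ` (SIGMA xs : independent_lists E m. E - vec.span (set xs))"
      by (auto simp: independent_lists_def vec.independent_insert
            intro!: image_eqI[where x = "(xs, x)"])
  next
    fix ys
    assume "ys \<in> (\<lambda>(xs, x). x # xs) ` (SIGMA xs : independent_lists E m. E - vec.span (set xs))"
    thus "ys \<in> independent_lists E (Suc m)"
      by (auto simp: independent_lists_def dest: vec.dependent_insertD vec.span_base)
  qed
  moreover have "inj_on (\<lambda>(xs, x). x # xs) (SIGMA xs : independent_lists E m. E - vec.span (set xs))"
    by (auto simp: inj_on_def)
  ultimately have "card (independent_lists E (Suc m)) =
      card (SIGMA xs : independent_lists E m. E - vec.span (set xs))"
    by (simp add: card_image)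
  also have "\<dots> = (\<Sum>xs\<in>independent_lists E m. card (E - vec.span (set xs)))"
    by (simp add: finite_independent_lists)
  also have "\<dots> = (\<Sum>xs\<in>independent_lists E m. CARD('a) ^ vec.dim E - CARD('a) ^ m)"
  proof (rule sum.cong[OF refl])
    fix xs assume xs: "xs \<in> independent_lists E m"
    hence "vec.span (set xs) \<subseteq> E"
      using E by (auto simp: independent_lists_def intro: vec.span_minimal[THEN subsetD])
    moreover have "vec.dim (vec.span (set xs)) = m"
      using xs by (auto simp: independent_lists_def vec.dim_eq_card_independent distinct_card)
    ultimately show "card (E - vec.span (set xs)) = CARD('a) ^ vec.dim E - CARD('a) ^ m"
      using card_subspace[OF E] card_subspace[OF vec.subspace_span, of "set xs"]
      by (simp add: card_Diff_subset)
  qed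
  finally show ?case using Suc by simp
qed

text \<open>By dimension, \<open>k\<close> independent vectors in \<open>W\<close> already span it.
  So the ordered bases of the \<open>k\<close>-dimensional subspaces are the fibres of the span map,
  hence pairwise disjoint.\<close>

lemma independent_lists_dim:
  fixes W :: "('a::field ^ 'n) set"
  assumes "vec.subspace W" "vec.dim W = k"
  shows "independent_lists W k = {xs \<in> independent_lists UNIV k. vec.span (set xs) = W}"
proof (intro equalityI subsetI)
  fix xs assume xs: "xs \<in> independent_lists W k"
  hence "vec.dim (set xs) = k"
    by (auto simp: independent_lists_def vec.dim_eq_card_independent distinct_card)
  moreover have "vec.span (set xs) \<subseteq> W"
    using xs assms by (auto simp: independent_lists_def intro: vec.span_minimal[THEN subsetD])
  ultimately have "vec.span (set xs) = W"
    using assms by (intro vec.subspace_dim_equal) auto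
  with xs show "xs \<in> {xs \<in> independent_lists UNIV k. vec.span (set xs) = W}"
    by (auto simp: independent_lists_def)
qed (auto simp: independent_lists_def intro: vec.span_base)

text \<open>Double counting of the independent lists of length \<open>k\<close>: sorted by their
  span, each subspace contributes the same number of ordered bases.\<close>

lemma card_subspaces:
  assumes "k \<le> CARD('n)"
  shows "real (card {W :: ('a::{field,finite} ^ 'n) set. vec.subspace W \<and> vec.dim W = k})
    = gauss_binomial CARD('a) CARD('n) k"
proof -
  let ?q = "CARD('a)" and ?n = "CARD('n)"
  let ?G = "{W :: ('a ^ 'n) set. vec.subspace W \<and> vec.dim W = k}"
  let ?I = "independent_lists (UNIV :: ('a ^ 'n) set) k"
  have q: "?q > 1"
    using card_mono[of UNIV "{0, 1 :: 'a}"] by simp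
  \<comment> \<open>Applied with \<open>m = n\<close> and with \<open>m = k\<close>: both products
    release the same powers of \<open>q\<close>, which then cancel, leaving the factors of the
    Gaussian binomial.\<close>
  have fac: "(\<Prod>j<k. real (?q ^ m - ?q ^ j)) = (\<Prod>j<k. real ?q ^ j) * (\<Prod>j<k. real ?q ^ (m - j) - 1)"
    if "k \<le> m" for m
    unfolding prod.distrib[symmetric]
  proof (rule prod.cong[OF refl])
    fix j assume "j \<in> {..<k}"
    hence "j \<le> m" using that by simp
    moreover have "?q ^ j \<le> ?q ^ m" using q \<open>j \<le> m\<close> by (intro power_increasing) auto
    ultimately show "real (?q ^ m - ?q ^ j) = real ?q ^ j * (real ?q ^ (m - j) - 1)"
      by (simp add: of_nat_diff algebra_simps flip: power_add)
  qed
  have "?I = (\<Union>W\<in>?G. independent_lists W k)"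
  proof (intro equalityI subsetI)
    fix xs assume xs: "xs \<in> ?I"
    hence "vec.span (set xs) \<in> ?G"
      by (auto simp: independent_lists_def vec.dim_eq_card_independent distinct_card)
    moreover have "xs \<in> independent_lists (vec.span (set xs)) k"
      using xs by (auto simp: independent_lists_def intro: vec.span_base)
    ultimately show "xs \<in> (\<Union>W\<in>?G. independent_lists W k)" by blast
  qed (auto simp: independent_lists_def)
  moreover have "card (\<Union>W\<in>?G. independent_lists W k) = (\<Sum>W\<in>?G. card (independent_lists W k))"
    by (intro card_UN_disjoint) (auto simp: finite_independent_lists independent_lists_dim)
  ultimately have "card ?I = (\<Sum>W\<in>?G. card (independent_lists W k))" by simp
  also have "\<dots> = (\<Sum>W\<in>?G. \<Prod>j<k. ?q ^ k - ?q ^ j)"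
    by (auto intro!: sum.cong simp: card_independent_lists)
  finally have "card ?I = card ?G * (\<Prod>j<k. ?q ^ k - ?q ^ j)" by simp
  moreover have "card ?I = (\<Prod>j<k. ?q ^ ?n - ?q ^ j)"
    using card_independent_lists[of "UNIV :: ('a ^ 'n) set" k] assms
    by (simp add: vec_dim_card del: vec.dim_UNIV)
  ultimately have "real (card ?G) * (\<Prod>j<k. real (?q ^ k - ?q ^ j)) = (\<Prod>j<k. real (?q ^ ?n - ?q ^ j))"
    by (metis (no_types, lifting) of_nat_mult of_nat_prod prod.cong)
  hence eq: "real (card ?G) * (\<Prod>j<k. real ?q ^ (k - j) - 1) = (\<Prod>j<k. real ?q ^ (?n - j) - 1)"
    using q assms by (simp only: fac[OF order.refl] fac[OF assms]) simp
  have "(\<Prod>j<k. real ?q ^ (k - j) - 1) \<noteq> 0"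
  proof -
    have "real ?q ^ (k - j) > 1" if "j < k" for j
      using q that by (intro one_less_power) auto
    thus ?thesis by force
  qed
  with eq show ?thesis
    unfolding gauss_binomial_def by (simp add: field_simps)
qed

section \<open>Sums over cosets\<close>

text \<open>Base point and direction are separate arguments, so that one can be fixed while the
  other varies.\<close>

definition coset_sum :: "('a::{field,finite} ^ 'n \<Rightarrow> real) \<Rightarrow> 'a ^ 'n \<Rightarrow> ('a ^ 'n) set \<Rightarrow> real" where
  "coset_sum c s W = (\<Sum>w\<in>W. c (s + w))"

lemma coset_sum_span_insert:
  assumes "vec.subspace W" "e \<notin> W"
  shows "coset_sum c s (vec.span (insert e W)) = (\<Sum>t\<in>UNIV. coset_sum c (s + t *s e) W)"
proof -
  have "coset_sum c s (vec.span (insert e W)) = (\<Sum>(t, w)\<in>UNIV \<times> W. c (s + (t *s e + w)))"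
    unfolding coset_sum_def
    by (subst sum.reindex_bij_betw[OF bij_betw_span_insert[OF assms], symmetric])
       (simp add: case_prod_unfold)
  thus ?thesis
    by (simp add: coset_sum_def sum.cartesian_product add.assoc)
qed

lemma coset_sum_translate:
  assumes "vec.subspace W" "v \<in> W"
  shows "coset_sum c (s + v) W = coset_sum c s W"
proof -
  have "bij_betw ((+) v) W W"
    by (rule bij_betw_byWitness[where f' = "\<lambda>w. w - v"])
       (use assms in \<open>auto intro: vec.subspace_add vec.subspace_diff\<close>)
  from sum.reindex_bij_betw[OF this, of "\<lambda>w. c (s + w)"] show ?thesis
    by (simp add: coset_sum_def add.assoc)
qed

section \<open>Hyperplanes as kernels of linear forms\<close>

lemma scalar_product_simps:
  fixes u v w :: "'a::field ^ 'n"
  shows "scalar_product u (v + w) = scalar_product u v + scalar_product u w"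
    and "scalar_product u (v - w) = scalar_product u v - scalar_product u w"
    and "scalar_product u (t *s v) = t * scalar_product u v"
    and "scalar_product (v - w) u = scalar_product v u - scalar_product w u"
    and "scalar_product (t *s v) u = t * scalar_product v u"
    and "scalar_product u 0 = 0"
    and "scalar_product 0 u = 0"
    and "scalar_product (v + w) u = scalar_product v u + scalar_product w u"
  by (simp_all add: scalar_product_def algebra_simps sum.distrib sum_subtractf sum_distrib_left)

lemma scalar_product_axis: "scalar_product (axis i t) v = t * v $ i"
  for v :: "'a::field ^ 'n"
  by (simp add: scalar_product_def axis_def if_distrib if_distribR sum.delta cong: if_cong)

text \<open>Vectors \<open>u\<close> stand for linear forms. Evaluation at \<open>v\<close> is
  nonzero on the coordinate form of some \<open>i\<close> with \<open>v $ i \<noteq> 0\<close>, so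
  every form is a multiple of that one plus a form vanishing at \<open>v\<close>.\<close>

lemma card_annihilator:
  fixes v :: "'a::{field,finite} ^ 'n"
  assumes "v \<noteq> 0"
  shows "CARD('a) * card {u. scalar_product u v = 0} = CARD('a ^ 'n)"
proof -
  let ?W = "{u. scalar_product u v = 0}"
  obtain i where i: "v $ i \<noteq> 0" using assms by (auto simp: vec_eq_iff)
  have W: "vec.subspace ?W" by (auto simp: vec.subspace_def scalar_product_simps)
  have e: "axis i 1 \<notin> ?W" using i by (simp add: scalar_product_axis)
  have "x \<in> vec.span (insert (axis i 1) ?W)" for x
    unfolding vec.span_breakdown_eq
    by (rule exI[of _ "scalar_product x v / v $ i"], rule vec.span_base)
       (use i in \<open>simp add: scalar_product_simps scalar_product_axis\<close>)
  hence "vec.span (insert (axis i 1) ?W) = UNIV" by blast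
  with bij_betw_same_card[OF bij_betw_span_insert[OF W e]] show ?thesis
    by (simp add: card_cartesian_product)
qed

lemma separating_linear_form:
  fixes v w :: "'a::field ^ 'n"
  assumes "v \<noteq> 0" "w \<notin> vec.span {v}"
  obtains u where "scalar_product u v = 0" "scalar_product u w \<noteq> 0"
proof -
  obtain i where i: "v $ i \<noteq> 0" using assms(1) by (auto simp: vec_eq_iff)
  have "w \<noteq> (w $ i / v $ i) *s v"
    using assms(2) by (metis vec.span_base vec.span_scale singletonI)
  then obtain j where j: "w $ j \<noteq> w $ i / v $ i * v $ j"
    by (auto simp: vec_eq_iff)
  \<comment> \<open>As a form, \<open>u\<close> sends \<open>x\<close> to the minor
    \<open>v $ i * x $ j - v $ j * x $ i\<close>, which vanishes at \<open>v\<close>; the choice of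
    \<open>j\<close> makes it nonzero at \<open>w\<close>.\<close>
  define u where "u = axis j (v $ i) - axis i (v $ j)"
  show thesis
  proof (rule that[of u])
    show "scalar_product u v = 0"
      by (simp add: u_def scalar_product_simps scalar_product_axis)
    show "scalar_product u w \<noteq> 0"
      using i j by (simp add: u_def scalar_product_simps scalar_product_axis field_simps)
  qed
qed

text \<open>
  Every hyperplane of \<open>E\<close> occurs equally often among the kernels on \<open>E\<close> of the linear forms
  that do not vanish on \<open>E\<close>, so averaging over these forms replaces a count of hyperplanes.
\<close>

lemma hyperplane_family:
  fixes E :: "('a::{field,finite} ^ 'n) set"
  assumes E: "vec.subspace E" and dim: "vec.dim E \<ge> 2"
  obtains A :: "('a ^ 'n) set" and H :: "'a ^ 'n \<Rightarrow> ('a ^ 'n) set" and l :: nat where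
    "\<And>a. a \<in> A \<Longrightarrow> vec.subspace (H a) \<and> H a \<subseteq> E \<and> vec.dim E = Suc (vec.dim (H a))"
    "\<And>v. v \<in> E \<Longrightarrow> v \<noteq> 0 \<Longrightarrow> card {a \<in> A. v \<in> H a} = l"
    "0 < l" "l < card A"
proof -
  define Z where "Z = {u. \<forall>v\<in>E. scalar_product u v = 0}"
  define A where "A = - Z"
  define H where "H u = {v \<in> E. scalar_product u v = 0}" for u
  \<comment> \<open>The forms killing a nonzero \<open>v\<close> are a fraction \<open>1/q\<close>
    of all forms, and for \<open>v\<close> in \<open>E\<close> they include all of \<open>Z\<close>;
    so the count does not depend on \<open>v\<close>.\<close>
  define l where "l = CARD('a ^ 'n) div CARD('a) - card Z"
  have zeros: "card {a \<in> A. v \<in> H a} = l"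
    if v: "v \<in> E" "v \<noteq> 0" for v
  proof -
    have Z: "Z \<subseteq> {u. scalar_product u v = 0}"
      using v by (auto simp: Z_def)
    have perp: "card {u. scalar_product u v = 0} = CARD('a ^ 'n) div CARD('a)"
      using card_annihilator[OF v(2)]
      by (metis nonzero_mult_div_cancel_left zero_less_card_finite less_irrefl)
    have "{a \<in> A. v \<in> H a} = {u. scalar_product u v = 0} - Z"
      using v by (auto simp: A_def H_def)
    thus "card {a \<in> A. v \<in> H a} = l"
      using Z perp by (simp add: card_Diff_subset l_def)
  qed
  have "vec.dim E \<noteq> 0" using dim by linarith
  hence "\<not> E \<subseteq> {0}" unfolding vec.dim_eq_0 .
  then obtain v where v: "v \<in> E" "v \<noteq> 0" by auto
  \<comment> \<open>Dimension at least 2 enters here: a form that kills \<open>v\<close> but not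
    some \<open>w\<close> in \<open>E\<close> belongs to \<open>A\<close>, so \<open>l\<close> is
    positive.\<close>
  have "\<not> E \<subseteq> vec.span {v}"
    using dim vec.dim_mono[of E "{v}"] vec.dim_le_card[of "{v}" "{v}"] vec.span_base[of v "{v}"]
    by auto
  then obtain w where w: "w \<in> E" "w \<notin> vec.span {v}" by blast
  obtain u where u: "scalar_product u v = 0" "scalar_product u w \<noteq> 0"
    using separating_linear_form[OF v(2) w(2)] .
  have l: "0 < l"
  proof -
    have "u \<in> A" "v \<in> H u" using u v w by (auto simp: A_def H_def Z_def)
    hence "card {a \<in> A. v \<in> H a} > 0" by (auto simp: card_gt_0_iff)
    thus ?thesis using zeros[OF v] by simp
  qed
  \<comment> \<open>The coordinate form at \<open>i\<close> lies in \<open>A\<close> but does not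
    kill \<open>v\<close>, whence \<open>l < card A\<close>.\<close>
  obtain i where i: "v $ i \<noteq> 0" using v(2) by (auto simp: vec_eq_iff)
  have "axis i 1 \<in> A - {a \<in> A. v \<in> H a}"
    using i v by (auto simp: A_def H_def Z_def scalar_product_axis)
  hence "{a \<in> A. v \<in> H a} \<subset> A" by blast
  hence l': "l < card A" using zeros[OF v] psubset_card_mono[of A] by auto
  show thesis
  proof (rule that[of A H l])
    fix a assume "a \<in> A"
    then obtain e where e: "e \<in> E" "scalar_product a e \<noteq> 0" by (auto simp: A_def Z_def)
    have H: "vec.subspace (H a)"
      using E by (auto simp: H_def vec.subspace_def scalar_product_simps)
    have "E \<subseteq> vec.span (insert e (H a))"
    proof
      fix x assume "x \<in> E"
      \<comment> \<open>The multiple of \<open>e\<close> is chosen to cancel the value of the form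
        \<open>a\<close> at \<open>x\<close>; so \<open>H a\<close> together with \<open>e\<close>
        spans \<open>E\<close>.\<close>
      hence "x - (scalar_product a x / scalar_product a e) *s e \<in> H a"
        using e E by (auto simp: H_def scalar_product_simps vec.subspace_diff vec.subspace_scale)
      thus "x \<in> vec.span (insert e (H a))"
        unfolding vec.span_breakdown_eq using vec.span_base by blast
    qed
    moreover have "vec.span (insert e (H a)) \<subseteq> E"
      using e E by (intro vec.span_minimal) (auto simp: H_def)
    ultimately have "vec.span (insert e (H a)) = E" by blast
    moreover have "vec.dim (insert e (H a)) = Suc (vec.dim (H a))"
      using e H by (simp add: vec.dim_insert vec.span_eq_iff[THEN iffD2]) (simp add: H_def)
    ultimately have "vec.dim E = Suc (vec.dim (H a))"
      by (metis vec.dim_span)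
    thus "vec.subspace (H a) \<and> H a \<subseteq> E \<and> vec.dim E = Suc (vec.dim (H a))"
      using H by (auto simp: H_def)
  qed (use zeros l l' in auto)
qed

text \<open>Exchange the sums: \<open>c (s + v)\<close> is counted once for each \<open>a\<close>
  with \<open>v\<close> in \<open>H a\<close>, that is \<open>card A\<close> times for
  \<open>v = 0\<close> and \<open>l\<close> times otherwise. The identity is quantified over
  \<open>c\<close> and \<open>s\<close> inside the conclusion, so one family serves several base
  points.\<close>

lemma hyperplane_averaging:
  fixes E :: "('a::{field,finite} ^ 'n) set"
  assumes E: "vec.subspace E" and dim: "vec.dim E \<ge> 2"
  obtains A :: "('a ^ 'n) set" and H :: "'a ^ 'n \<Rightarrow> ('a ^ 'n) set" and l :: nat where
    "\<And>a. a \<in> A \<Longrightarrow> vec.subspace (H a) \<and> H a \<subseteq> E \<and> vec.dim E = Suc (vec.dim (H a))"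
    "\<And>v. v \<in> E \<Longrightarrow> v \<noteq> 0 \<Longrightarrow> card {a \<in> A. v \<in> H a} = l"
    "0 < l" "l < card A"
    "\<And>c s. (\<Sum>a\<in>A. coset_sum c s (H a)) = (real (card A) - real l) * c s + real l * coset_sum c s E"
proof -
  obtain A :: "('a ^ 'n) set" and H l where *:
    "\<And>a. a \<in> A \<Longrightarrow> vec.subspace (H a) \<and> H a \<subseteq> E \<and> vec.dim E = Suc (vec.dim (H a))"
    "\<And>v. v \<in> E \<Longrightarrow> v \<noteq> 0 \<Longrightarrow> card {a \<in> A. v \<in> H a} = l"
    "0 < l" "l < card A"
    by (rule hyperplane_family[OF assms]) (rule that)
  have "(\<Sum>a\<in>A. coset_sum c s (H a)) = (real (card A) - real l) * c s + real l * coset_sum c s E" for c s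
  proof -
    have 0: "0 \<in> E" using E by (simp add: vec.subspace_0)
    have "(\<Sum>a\<in>A. coset_sum c s (H a)) = (\<Sum>a\<in>A. \<Sum>v\<in>E. of_bool (v \<in> H a) * c (s + v))"
    proof (rule sum.cong[OF refl])
      fix a assume "a \<in> A"
      hence "E \<inter> H a = H a" using *(1) by blast
      thus "coset_sum c s (H a) = (\<Sum>v\<in>E. of_bool (v \<in> H a) * c (s + v))"
        by (simp add: coset_sum_def of_bool_def if_distribR sum.If_cases Int_def[symmetric] Collect_mem_eq
            if_distrib[of "\<lambda>x. x * _"] cong: if_cong)
    qed
    also have "\<dots> = (\<Sum>v\<in>E. real (card {a \<in> A. v \<in> H a}) * c (s + v))"
      by (subst sum.swap) (simp flip: sum_distrib_right add: Int_def)
    also have "\<dots> = real (card {a \<in> A. 0 \<in> H a}) * c s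
        + (\<Sum>v\<in>E - {0}. real (card {a \<in> A. v \<in> H a}) * c (s + v))"
      using 0 by (simp add: sum.remove)
    also have "{a \<in> A. 0 \<in> H a} = A" using *(1) by (auto simp: vec.subspace_0)
    also have "(\<Sum>v\<in>E - {0}. real (card {a \<in> A. v \<in> H a}) * c (s + v))
        = (\<Sum>v\<in>E - {0}. real l * c (s + v))"
      using *(2) by (intro sum.cong) auto
    also have "\<dots> = real l * (coset_sum c s E - c s)"
      using 0 by (simp add: coset_sum_def sum_diff1 flip: sum_distrib_left)
    finally show ?thesis by (simp add: algebra_simps)
  qed
  with * show thesis by (rule that)
qed

section \<open>Cameron-Liebler sets that are locally a pencil\<close>

text \<open>The hypothesis \<open>pencil\<close> says that \<open>p + v + W\<close> has sum 1
  exactly when it contains \<open>p\<close>. Then \<open>p + E\<close> has total weight 1 and so has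
  each \<open>p + H a\<close>, and averaging at \<open>p\<close> leaves
  \<open>c p = 1\<close>.\<close>

lemma weight_of_pencil_vertex:
  fixes E :: "('a::{field,finite} ^ 'n) set"
  assumes E: "vec.subspace E" "vec.dim E = Suc k" "1 \<le> k"
    and pencil: "\<And>W v. vec.subspace W \<Longrightarrow> W \<subseteq> E \<Longrightarrow> vec.dim W = k \<Longrightarrow> v \<in> E \<Longrightarrow>
      coset_sum c (p + v) W = of_bool (v \<in> W)"
  shows "c p = 1"
proof -
  have "2 \<le> vec.dim E" using E by simp
  with E(1) obtain A :: "('a ^ 'n) set" and H l where *:
    "\<And>a. a \<in> A \<Longrightarrow> vec.subspace (H a) \<and> H a \<subseteq> E \<and> vec.dim E = Suc (vec.dim (H a))"
    "\<And>v. v \<in> E \<Longrightarrow> v \<noteq> 0 \<Longrightarrow> card {a \<in> A. v \<in> H a} = l"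
    "0 < l" "l < card A"
    "\<And>c s. (\<Sum>a\<in>A. coset_sum c s (H a)) = (real (card A) - real l) * c s + real l * coset_sum c s E"
    by (rule hyperplane_averaging) (rule that)
  from *(4) obtain a where a: "a \<in> A" by fastforce
  note Ha = *(1)[OF a]
  have "H a \<noteq> E" using Ha by auto
  then obtain e where e: "e \<in> E" "e \<notin> H a" using Ha by blast
  \<comment> \<open>Among the parallel translates of \<open>p + H a\<close> that partition
    \<open>p + E\<close>, only the one with \<open>t = 0\<close> contains \<open>p\<close>; it alone
    contributes to the total.\<close>
  have "t *s e \<in> H a \<longleftrightarrow> t = 0" for t
  proof
    assume "t *s e \<in> H a"
    hence "inverse t *s (t *s e) \<in> H a" using Ha vec.subspace_scale by blast
    hence "(inverse t * t) *s e \<in> H a" by (simp only: vec.scale_scale)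
    thus "t = 0" using e(2) by (cases "t = 0") simp_all
  qed (use Ha in \<open>simp add: vec.subspace_0\<close>)
  hence "coset_sum c (p + t *s e) (H a) = of_bool (t = 0)" for t
    using pencil[of "H a" "t *s e"] Ha E e by (simp add: vec.subspace_scale)
  hence "coset_sum c p E = (\<Sum>t\<in>(UNIV :: 'a set). of_bool (t = 0))"
    using coset_sum_span_insert[of "H a" e c p] hyperplane_span_insert[of E "H a" e] Ha E e by simp
  hence "coset_sum c p E = 1" by simp
  moreover have "(\<Sum>a\<in>A. coset_sum c p (H a)) = (\<Sum>a\<in>A. 1)"
  proof (rule sum.cong[OF refl])
    fix a assume "a \<in> A"
    thus "coset_sum c p (H a) = 1"
      using pencil[of "H a" 0] *(1)[of a] E by (auto simp: vec.subspace_0)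
  qed
  ultimately have "(real (card A) - real l) * (c p - 1) = 0"
    using *(5)[of c p] by (simp add: algebra_simps)
  thus ?thesis using *(4) by simp
qed

text \<open>
  Since each coset sum is at most \<open>1\<close>, averaging at \<open>p\<close> bounds the total weight of \<open>p + E\<close> by
  \<open>1\<close>, while the translates of \<open>W\<close> show that it is at least \<open>1\<close>. Equality in the average then forces all
  hyperplanes of \<open>p + E\<close> through \<open>p\<close> to have sum \<open>1\<close>, and all others to have sum \<open>0\<close>.
\<close>

lemma weight_indicator:
  fixes E :: "('a::{field,finite} ^ 'n) set"
  assumes E: "vec.subspace E" "vec.dim E = Suc k" "1 \<le> k"
    and bool: "\<And>W s. vec.subspace W \<Longrightarrow> vec.dim W = k \<Longrightarrow> coset_sum c s W \<in> {0, 1}"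
    and p: "c p = 1"
    and W: "vec.subspace W" "vec.dim W = k" "W \<subseteq> E" "coset_sum c p W = 1"
    and v: "v \<in> E" "v \<noteq> 0"
  shows "c (p + v) = 0"
proof -
  have "2 \<le> vec.dim E" using E by simp
  with E(1) obtain A :: "('a ^ 'n) set" and H l where *:
    "\<And>a. a \<in> A \<Longrightarrow> vec.subspace (H a) \<and> H a \<subseteq> E \<and> vec.dim E = Suc (vec.dim (H a))"
    "\<And>v. v \<in> E \<Longrightarrow> v \<noteq> 0 \<Longrightarrow> card {a \<in> A. v \<in> H a} = l"
    "0 < l" "l < card A"
    "\<And>c s. (\<Sum>a\<in>A. coset_sum c s (H a)) = (real (card A) - real l) * c s + real l * coset_sum c s E"
    by (rule hyperplane_averaging) (rule that)
  \<comment> \<open>These are the translates with \<open>t = 0\<close> and \<open>t = 1\<close> out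
    of those partitioning \<open>p + E\<close>; the remaining ones have nonnegative sum by
    \<open>bool\<close>.\<close>
  have sum2: "coset_sum c p X + coset_sum c (p + e) X \<le> coset_sum c p E"
    if X: "vec.subspace X" "vec.dim X = k" "X \<subseteq> E" "e \<in> E" "e \<notin> X" for X e
  proof -
    have "coset_sum c p X + coset_sum c (p + e) X = (\<Sum>t\<in>{0, 1}. coset_sum c (p + t *s e) X)"
      by simp
    also have "\<dots> \<le> (\<Sum>t\<in>UNIV. coset_sum c (p + t *s e) X)"
      using bool[OF X(1,2)] by (intro sum_mono2) (auto, smt (verit))
    also have "\<dots> = coset_sum c p E"
      using coset_sum_span_insert[of X e c p] hyperplane_span_insert[of E X e] X E by simp
    finally show ?thesis .
  qed
  have pos: "0 \<le> coset_sum c s X" and le: "coset_sum c s X \<le> 1"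
    if "vec.subspace X" "vec.dim X = k" for s X
    using bool[OF that, of s] by auto
  have Hk: "vec.subspace (H a)" "vec.dim (H a) = k" "H a \<subseteq> E" if "a \<in> A" for a
    using *(1)[OF that] E by auto
  obtain e where "e \<in> E" "e \<notin> W" using W E by (metis n_not_Suc_n subsetI subset_antisym)
  with sum2[OF W(1-3)] pos[OF W(1,2), of "p + e"] W(4) have ge: "coset_sum c p E \<ge> 1" by fastforce
  have "(\<Sum>a\<in>A. coset_sum c p (H a)) \<le> (\<Sum>a\<in>A. 1)"
    by (rule sum_mono) (use le Hk in auto)
  hence "real l * coset_sum c p E \<le> real l * 1"
    using *(5)[of c p] p by simp
  hence "coset_sum c p E \<le> 1" using *(3) by (simp add: mult_le_cancel_left_pos)
  with ge have total: "coset_sum c p E = 1" by simp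
  \<comment> \<open>With \<open>c p = 1\<close> and total 1, the average is attained exactly; the
    nonnegative defects add up to 0, so each vanishes.\<close>
  hence "(\<Sum>a\<in>A. 1 - coset_sum c p (H a)) = 0"
    using *(5)[of c p] p by (simp add: sum_subtractf)
  hence one: "coset_sum c p (H a) = 1" if "a \<in> A" for a
    using that le Hk by (subst (asm) sum_nonneg_eq_0_iff) auto
  \<comment> \<open>If \<open>v\<close> is in \<open>H a\<close>, the coset is
    \<open>p + H a\<close> again. Otherwise it is a parallel translate, and \<open>p + H a\<close>
    already uses up the total weight 1.\<close>
  have "(\<Sum>a\<in>A. coset_sum c (p + v) (H a)) = (\<Sum>a\<in>A. of_bool (v \<in> H a))"
  proof (rule sum.cong[OF refl])
    fix a assume a: "a \<in> A"
    show "coset_sum c (p + v) (H a) = of_bool (v \<in> H a)"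
    proof (cases "v \<in> H a")
      case True
      thus ?thesis using one[OF a] Hk[OF a] by (simp add: coset_sum_translate)
    next
      case False
      thus ?thesis
        using sum2[OF Hk[OF a] v(1) False] one[OF a] total pos[OF Hk(1)[OF a] Hk(2)[OF a], of "p + v"] by simp
    qed
  qed
  also have "\<dots> = real l" using *(2)[OF v] by (simp add: Int_def)
  \<comment> \<open>Since \<open>v\<close> is in \<open>E\<close>, moving the base point to
    \<open>p + v\<close> keeps the total weight 1. Comparison with \<open>l\<close> leaves
    \<open>(card A - l) * c (p + v) = 0\<close>.\<close>
  also have "(\<Sum>a\<in>A. coset_sum c (p + v) (H a)) = (real (card A) - real l) * c (p + v) + real l"
    using *(5)[of c "p + v"] total coset_sum_translate[OF E(1) v(1), of c p] by simp
  finally show ?thesis using *(4) by simp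
qed

lemma coset_eq:
  fixes W :: "('a::field ^ 'n) set"
  assumes "vec.subspace W" "p \<in> (\<lambda>w. a + w) ` W"
  shows "(\<lambda>w. a + w) ` W = (\<lambda>w. p + w) ` W"
proof -
  obtain w where w: "w \<in> W" "p = a + w" using assms by blast
  show ?thesis
  proof (intro equalityI subsetI)
    fix x assume "x \<in> (\<lambda>w. a + w) ` W"
    then obtain y where "y \<in> W" "x = a + y" by blast
    with w assms show "x \<in> (\<lambda>w. p + w) ` W"
      by (intro image_eqI[where x = "y - w"]) (auto intro: vec.subspace_diff)
  next
    fix x assume "x \<in> (\<lambda>w. p + w) ` W"
    then obtain y where "y \<in> W" "x = p + y" by blast
    with w assms show "x \<in> (\<lambda>w. a + w) ` W"
      by (intro image_eqI[where x = "w + y"]) (auto intro: vec.subspace_add)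
  qed
qed

text \<open>With \<open>p\<close> as base point, a \<open>k\<close>-space through \<open>p\<close>
  is determined by its direction, so the pencil is in bijection with the
  \<open>k\<close>-dimensional linear subspaces.\<close>

lemma card_pencil:
  fixes p :: "'a::{field,finite} ^ 'n"
  assumes "k \<le> CARD('n)"
  shows "real (card {K \<in> ag_spaces k. p \<in> K}) = gauss_binomial CARD('a) CARD('n) k"
proof -
  let ?G = "{W :: ('a ^ 'n) set. vec.subspace W \<and> vec.dim W = k}"
  have "{K \<in> ag_spaces k. p \<in> K} = (\<lambda>W. (+) p ` W) ` ?G"
  proof (intro equalityI subsetI)
    fix K assume "K \<in> {K \<in> ag_spaces k. p \<in> K}"
    then obtain a W where W: "W \<in> ?G" "K = (\<lambda>w. a + w) ` W" "p \<in> (\<lambda>w. a + w) ` W"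
      by (auto simp: ag_spaces_def)
    have "K = (+) p ` W" using coset_eq[OF _ W(3)] W(1,2) by blast
    with W(1) show "K \<in> (\<lambda>W. (+) p ` W) ` ?G" by blast
  next
    fix K assume "K \<in> (\<lambda>W. (+) p ` W) ` ?G"
    then obtain W where W: "W \<in> ?G" "K = (+) p ` W" by blast
    hence "p \<in> K" by (auto simp: vec.subspace_0 intro!: image_eqI[where x = 0])
    with W show "K \<in> {K \<in> ag_spaces k. p \<in> K}" by (auto simp: ag_spaces_def)
  qed
  moreover have "inj_on (\<lambda>W. (+) p ` W) ?G"
    by (auto simp: inj_on_def inj_image_eq_iff)
  ultimately show ?thesis
    using card_subspaces[OF assms, where 'a = 'a] by (simp add: card_image)
qed

theorem theorem3p7:
  fixes L :: "('a::{field,finite} ^ 'n) set set"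
    and U :: "('a ^ 'n) set"
    and p :: "'a ^ 'n"
    and k i :: nat
  assumes "1 \<le> k"
    and "CARD('n) \<ge> 2 * k + 1"
    and "i \<ge> k + 1"
    and "cameron_liebler k L"
    and "U \<in> ag_spaces i"
    and "p \<in> U"
    and "L \<inter> ag_spaces_in k U = {K \<in> ag_spaces_in k U. p \<in> K}"
  shows "cameron_liebler k L \<and> has_parameter k L 1 \<and> L = {K \<in> ag_spaces k. p \<in> K}"
proof -
  \<comment> \<open>The coefficients of the rows in the combination serve as weights of the
    points.\<close>
  obtain c :: "'a ^ 'n \<Rightarrow> real" where
    c: "\<And>K. K \<in> ag_spaces k \<Longrightarrow> of_bool (K \<in> L) = (\<Sum>P\<in>UNIV. c P * of_bool (P \<in> K))"
    and L: "L \<subseteq> ag_spaces k"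
    using assms(4) unfolding cameron_liebler_def row_space_def char_vector_def incidence_matrix_def
    by blast
  have sum: "coset_sum c s W = of_bool ((+) s ` W \<in> L)" if W: "vec.subspace W" "vec.dim W = k" for s W
  proof -
    have "(+) s ` W \<in> ag_spaces k" using W by (auto simp: ag_spaces_def)
    from c[OF this] have "of_bool ((+) s ` W \<in> L) = (\<Sum>P\<in>(+) s ` W. c P)"
      by (simp add: of_bool_def if_distrib sum.If_cases cong: if_cong)
    thus ?thesis by (simp add: coset_sum_def sum.reindex)
  qed
  obtain a V where V: "vec.subspace V" "vec.dim V = i" and "U = (\<lambda>w. a + w) ` V"
    using assms(5) by (auto simp: ag_spaces_def)
  hence U: "U = (\<lambda>w. p + w) ` V"
    using coset_eq assms(6) by blast
  obtain E where E: "vec.subspace E" "E \<subseteq> V" "vec.dim E = Suc k"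
    using subspace_of_dim_exists[of V "Suc k"] V assms(3) by auto
  \<comment> \<open>All these cosets lie in \<open>p + E\<close>, hence in \<open>U\<close>, where
    membership in \<open>L\<close> means containing \<open>p\<close>; and \<open>p\<close> is in
    \<open>p + v + W\<close> iff \<open>- v\<close>, equivalently \<open>v\<close>, is in
    \<open>W\<close>.\<close>
  have pencil: "coset_sum c (p + v) W = of_bool (v \<in> W)"
    if W: "vec.subspace W" "W \<subseteq> E" "vec.dim W = k" and v: "v \<in> E" for W v
  proof -
    let ?K = "(+) (p + v) ` W"
    have "?K \<subseteq> U"
    proof
      fix x assume "x \<in> ?K"
      then obtain w where "w \<in> W" "x = p + (v + w)" by (auto simp: add.assoc)
      moreover have "v + w \<in> V" using \<open>w \<in> W\<close> W v E V by (auto intro!: vec.subspace_add)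
      ultimately show "x \<in> U" using U by blast
    qed
    hence "?K \<in> ag_spaces_in k U"
      using W by (auto simp: ag_spaces_in_def ag_spaces_def)
    hence "?K \<in> L \<longleftrightarrow> p \<in> ?K" using assms(7) by blast
    also have "p \<in> ?K \<longleftrightarrow> (\<exists>w\<in>W. v + w = 0)"
      by (auto simp: image_iff add.assoc)
    also have "\<dots> \<longleftrightarrow> v \<in> W"
    proof
      assume "\<exists>w\<in>W. v + w = 0"
      then obtain w where "w \<in> W" "v = - w" by (auto simp: eq_neg_iff_add_eq_0)
      thus "v \<in> W" using vec.subspace_neg[OF W(1)] by blast
    next
      assume "v \<in> W"
      thus "\<exists>w\<in>W. v + w = 0" using vec.subspace_neg[OF W(1)] by (intro bexI[of _ "- v"]) auto
    qed
    finally show ?thesis using sum[OF W(1,3)] by simp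
  qed
  have cp: "c p = 1"
    using weight_of_pencil_vertex[OF E(1,3) assms(1) pencil] .
  \<comment> \<open>The member \<open>p + W\<close> of \<open>L\<close> is the seed: it lets
    \<open>weight_indicator\<close> be applied in \<open>(k+1)\<close>-spaces that leave
    \<open>U\<close>.\<close>
  obtain W where W: "vec.subspace W" "W \<subseteq> E" "vec.dim W = k"
    using subspace_of_dim_exists[of E k] E by auto
  have W1: "coset_sum c p W = 1"
    using pencil[OF W, of 0] W(1) E(1) by (simp add: vec.subspace_0)
  have bool: "coset_sum c s X \<in> {0, 1}" if "vec.subspace X" "vec.dim X = k" for s X
    using sum[OF that] by simp
  \<comment> \<open>A \<open>(k+1)\<close>-dimensional direction space containing both
    \<open>W\<close> and \<open>v\<close> is required: \<open>E\<close> does if \<open>v\<close> is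
    in \<open>W\<close>, and otherwise \<open>W\<close> extended by \<open>v\<close>.\<close>
  have "c (p + v) = 0" if v: "v \<noteq> 0" for v
  proof (cases "v \<in> W")
    case True
    thus ?thesis
      using weight_indicator[OF E(1,3) assms(1) bool cp W(1,3,2) W1 _ v] W(2) by blast
  next
    case False
    let ?F = "vec.span (insert v W)"
    have "vec.dim ?F = Suc k"
      using False W by (simp add: vec.dim_insert vec.span_eq_iff[THEN iffD2])
    moreover have "W \<subseteq> ?F" "v \<in> ?F" by (auto intro: vec.span_base)
    ultimately show ?thesis
      using weight_indicator[OF vec.subspace_span _ assms(1) bool cp W(1,3) _ W1 _ v] by blast
  qed
  from this[of "x - p" for x] have c0: "c x = of_bool (x = p)" for x
    using cp by (cases "x = p") auto
  have "K \<in> L \<longleftrightarrow> p \<in> K" if "K \<in> ag_spaces k" for K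
  proof -
    have "(of_bool (K \<in> L) :: real) = of_bool (p \<in> K)"
      using c[OF that] by (simp add: c0 of_bool_def if_distrib[of "\<lambda>x. x * _"] cong: if_cong)
    thus ?thesis by (simp add: of_bool_eq_iff)
  qed
  with L have "L = {K \<in> ag_spaces k. p \<in> K}" by blast
  moreover have "has_parameter k L 1"
    unfolding has_parameter_def calculation using card_pencil[of k p] assms(2) by simp
  ultimately show ?thesis using assms(4) by blast
qed

end
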